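(* Let $R$ be an $s$-unital ring and let $G$ be a group. Then the group ring $R[G]$ is prime if and only if $R$ is prime and $G$ has no non-trivial finite normal subgroup.
   Context: Rings are associative but not necessarily unital; ideals are two-sided. A ring $R$ is $s$-unital if $r\in rR\cap Rr$ for every $r\in R$. A ring $R$ is prime if $\{0\}$ is a proper ideal and for all ideals $A,B$ of $R$, $AB=\{0\}$ implies $A=\{0\}$ or $B=\{0\}$. The group ring $R[G]$ is the set of formal sums $\sum_{x\in G}r_x\delta_x$, with $r_x\in R$ zero for all but finitely many $x\in G$, with componentwise addition and multiplication extending bilinearly $(r\delta_x)(r'\delta_y)=rr'\delta_{xy}$. A subgroup is non-trivial if it is not $\{e\}$, where $e$ is the neutral element of $G$. *)

theory Defs
  imports "HOL-Library.Poly_Mapping"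
begin

text \<open>
  Rings are types of class \<open>ring\<close>, which is associative and does not require a unit.
  Groups are types of class \<open>group_add\<close>, which is not assumed commutative: the group
  operation is written \<open>+\<close>, the neutral element \<open>0\<close> and the inverse of \<open>g\<close> is \<open>- g\<close>.

  The group ring \<open>R[G]\<close> is the type \<open>'g \<Rightarrow>\<^sub>0 'r\<close> of finitely supported functions. Its
  \<open>ring\<close> instance in the library is pointwise addition and convolution; the element
  \<open>r \<delta>\<^sub>x\<close> is \<open>Poly_Mapping.single x r\<close>, and \<open>mult_single\<close> is the defining rule
  \<open>(r \<delta>\<^sub>x) (r' \<delta>\<^sub>y) = r r' \<delta>\<^sub>x\<^sub>y\<close>.
\<close>

definition is_subgroup :: "'a::group_add set \<Rightarrow> bool" where
  "is_subgroup H \<longleftrightarrow> 0 \<in> H \<and> (\<forall>x\<in>H. \<forall>y\<in>H. x + y \<in> H) \<and> (\<forall>x\<in>H. - x \<in> H)"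

definition is_normal_subgroup :: "'a::group_add set \<Rightarrow> bool" where
  "is_normal_subgroup N \<longleftrightarrow> is_subgroup N \<and> (\<forall>g. \<forall>n\<in>N. g + n + (- g) \<in> N)"

definition is_ideal :: "'a::ring set \<Rightarrow> bool" where
  "is_ideal I \<longleftrightarrow> is_subgroup I \<and> (\<forall>r. \<forall>a\<in>I. r * a \<in> I \<and> a * r \<in> I)"

text \<open>The product \<open>AB\<close> of ideals: all finite sums of products \<open>a b\<close>, the empty sum included.\<close>

definition ideal_mult :: "'a::ring set \<Rightarrow> 'a set \<Rightarrow> 'a set" where
  "ideal_mult A B =
     {s. \<exists>(n::nat) a b. (\<forall>i<n. a i \<in> A \<and> b i \<in> B) \<and> s = (\<Sum>i<n. a i * b i)}"

definition s_unital :: "'a::ring itself \<Rightarrow> bool" where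
  "s_unital _ \<longleftrightarrow> (\<forall>r::'a. r \<in> range (\<lambda>x. r * x) \<inter> range (\<lambda>x. x * r))"

definition prime_ring :: "'a::ring itself \<Rightarrow> bool" where
  "prime_ring _ \<longleftrightarrow>
     {0::'a} \<noteq> UNIV \<and>
     (\<forall>A B :: 'a set. is_ideal A \<longrightarrow> is_ideal B \<longrightarrow> ideal_mult A B = {0} \<longrightarrow> A = {0} \<or> B = {0})"

end

theory Submission
  imports Defs "HOL-Library.FuncSet"
begin

text \<open>
  For a finite normal subgroup \<open>N\<close>, the ideal of \<open>N\<close>-invariant elements of \<open>R[G]\<close> has a
  non-zero right annihilator, so primeness of \<open>R[G]\<close> forces \<open>N\<close> to be trivial.
  Conversely, if \<open>G\<close> has no non-trivial finite normal subgroup, then its FC-centre \<open>D\<close>, the set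
  of elements with finitely many conjugates, is torsion-free abelian, hence orderable. Given
  \<open>a\<close> and \<open>b\<close> whose supports meet \<open>D\<close>, some product \<open>p q\<close> of elements of the supports is unique
  within \<open>D\<close>. By B. H. Neumann's covering lemma there is an \<open>x\<close> that centralizes the part of
  the support of \<open>b\<close> inside \<open>D\<close> and moves the other part so far that \<open>a (r \<delta>\<^sub>x) b\<close> has the
  coefficient \<open>a\<^sub>p r b\<^sub>q\<close> at \<open>p q x\<close>; primeness of \<open>R\<close> makes it non-zero for a suitable \<open>r\<close>.
\<close>

section \<open>Finite normal subgroups and the FC-centre\<close>

text \<open>The power of \<open>x\<close> in additive notation, encoded as the value of a constant
  word so that statements about words apply to it directly.\<close>

abbreviation nmul :: "nat \<Rightarrow> 'a::monoid_add \<Rightarrow> 'a" where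
  "nmul n x \<equiv> sum_list (replicate n x)"

lemma nmul_add: "nmul (m + n) x = nmul m x + nmul n x"
  by (simp add: replicate_add)

lemma nmul_nmul: "nmul m (nmul n x) = nmul (m * n) x"
  by (induction m) (simp_all add: nmul_add)

lemma sum_list_conj:
  fixes g :: "'a::group_add"
  shows "sum_list (map (\<lambda>x. g + x - g) xs) = g + sum_list xs - g"
  by (induction xs) (simp_all add: add.assoc diff_conv_add_uminus del: add_uminus_conv_diff)

lemma nmul_conj: "nmul n (g + x - g) = g + nmul n x - (g::'a::group_add)"
  using sum_list_conj[of g "replicate n x"] by simp

lemma nmul_uminus: "nmul n (- x) = - nmul n (x::'a::group_add)"
proof (induction n)
  case (Suc n)
  have "nmul (Suc n) x = nmul n x + x"
    using nmul_add[of n 1 x] by simp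
  with Suc show ?case by (simp add: minus_add)
qed simp

lemma sum_list_uminus_rev: "sum_list (rev (map uminus xs)) = - sum_list (xs::'a::group_add list)"
  by (induction xs) (simp_all add: minus_add)

text \<open>Moving a copy of \<open>x\<close> to the front past a letter \<open>w\<close> replaces
  \<open>w\<close> by a conjugate. That conjugate is again in \<open>X\<close>, and the length of
  the word does not change.\<close>

lemma words_pull_front:
  fixes X :: "'a::group_add set"
  assumes conj: "\<And>g x. x \<in> X \<Longrightarrow> g + x - g \<in> X"
  assumes "set ws \<subseteq> X" "n \<le> count_list ws x"
  shows "\<exists>vs. set vs \<subseteq> X \<and> length ws = n + length vs \<and>
           sum_list ws = nmul n x + sum_list vs"
  using assms(2,3)
proof (induction ws arbitrary: n)
  case (Cons w ws)
  show ?case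
  proof (cases "w = x \<and> n \<noteq> 0")
    case True
    then obtain m where m: "n = Suc m" by (cases n) auto
    with Cons.prems True have "m \<le> count_list ws x" by simp
    with Cons.IH[of m] Cons.prems obtain vs where
      "set vs \<subseteq> X" "length ws = m + length vs" "sum_list ws = nmul m x + sum_list vs" by auto
    with True m show ?thesis by (intro exI[of _ vs]) (auto simp: add.assoc)
  next
    case False
    with Cons.prems have "n \<le> count_list ws x" by (auto split: if_splits)
    with Cons.IH[of n] Cons.prems obtain vs where vs:
      "set vs \<subseteq> X" "length ws = n + length vs" "sum_list ws = nmul n x + sum_list vs" by auto
    let ?w = "(- nmul n x) + w - (- nmul n x)"
    have "?w \<in> X" using Cons.prems by (intro conj) simp
    moreover have "w + (nmul n x + sum_list vs) = nmul n x + (?w + sum_list vs)"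
      by (simp add: add.assoc)
    ultimately show ?thesis using vs by (intro exI[of _ "?w # vs"]) auto
  qed
qed simp

text \<open>A common generalisation of Dietzmann's lemma (where \<open>vs\<close> is empty) and of the
  rewriting step in Schur's theorem on central-by-finite groups.\<close>

lemma finite_words:
  fixes X :: "'a::group_add set"
  assumes conj: "\<And>g x. x \<in> X \<Longrightarrow> g + x - g \<in> X"
  assumes fin: "finite X"
  assumes short: "\<And>x. x \<in> X \<Longrightarrow> \<exists>n vs. set vs \<subseteq> X \<and> length vs < n \<and> nmul n x = sum_list vs"
  shows "finite (sum_list ` {ws. set ws \<subseteq> X})"
proof -
  from short obtain n where
    n: "\<And>x. x \<in> X \<Longrightarrow> \<exists>vs. set vs \<subseteq> X \<and> length vs < n x \<and> nmul (n x) x = sum_list vs"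
    by metis
  \<comment> \<open>Pigeonhole bound: a word over \<open>X\<close> with more than \<open>N\<close>
    letters contains some letter \<open>x\<close> at least \<open>n x\<close> times. Those copies
    can be collected in front and replaced by a shorter word.\<close>
  define N where "N = (\<Sum>x\<in>X. n x)"
  have step: "\<exists>ws'. set ws' \<subseteq> X \<and> length ws' < length ws \<and> sum_list ws' = sum_list ws"
    if ws: "set ws \<subseteq> X" "length ws > N" for ws
  proof -
    have "\<exists>x\<in>X. n x \<le> count_list ws x"
    proof (rule ccontr)
      assume "\<not> ?thesis"
      then have "(\<Sum>x\<in>X. count_list ws x) \<le> N"
        unfolding N_def by (intro sum_mono) auto
      with ws fin show False by (simp add: sum_count_set)
    qed
    then obtain x where x: "x \<in> X" "n x \<le> count_list ws x" by blast
    obtain vs where vs: "set vs \<subseteq> X" "length ws = n x + length vs"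
      "sum_list ws = nmul (n x) x + sum_list vs"
      using words_pull_front[OF conj ws(1) x(2)] by blast
    obtain us where "set us \<subseteq> X" "length us < n x" "nmul (n x) x = sum_list us"
      using n[OF x(1)] by blast
    with vs show ?thesis by (intro exI[of _ "us @ vs"]) auto
  qed
  have bound: "\<exists>ws'. set ws' \<subseteq> X \<and> length ws' \<le> N \<and> sum_list ws' = sum_list ws"
    if "set ws \<subseteq> X" for ws
    using that
  proof (induction ws rule: length_induct)
    case (1 ws)
    show ?case
    proof (cases "length ws \<le> N")
      case False
      with step[of ws] 1 show ?thesis by (metis not_le)
    qed (use 1 in blast)
  qed
  have "sum_list ` {ws. set ws \<subseteq> X} \<subseteq> sum_list ` {ws. set ws \<subseteq> X \<and> length ws \<le> N}"
    using bound by (auto simp: image_iff) metis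
  with finite_lists_length_le[OF fin] show ?thesis
    by (meson finite_imageI finite_subset)
qed

definition no_finite_normal :: "'a::group_add itself \<Rightarrow> bool" where
  "no_finite_normal _ \<longleftrightarrow> \<not> (\<exists>N :: 'a set. is_normal_subgroup N \<and> finite N \<and> N \<noteq> {0})"

text \<open>The values of words over \<open>X\<close> form a subgroup because \<open>X\<close> is
  closed under negation, and a normal one because \<open>X\<close> is closed under conjugation.
  \<open>finite_words\<close> makes it finite, hence trivial.\<close>

lemma no_finite_normal_trivial:
  fixes X :: "'a::group_add set"
  assumes G: "no_finite_normal TYPE('a)"
  assumes conj: "\<And>g x. x \<in> X \<Longrightarrow> g + x - g \<in> X"
  assumes neg: "\<And>x. x \<in> X \<Longrightarrow> - x \<in> X"
  assumes fin: "finite X"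
  assumes short: "\<And>x. x \<in> X \<Longrightarrow> \<exists>n vs. set vs \<subseteq> X \<and> length vs < n \<and> nmul n x = sum_list vs"
  assumes "x \<in> X"
  shows "x = 0"
proof -
  let ?N = "sum_list ` {ws. set ws \<subseteq> X}"
  have "is_subgroup ?N"
    unfolding is_subgroup_def
  proof (intro conjI ballI)
    show "0 \<in> ?N" by (rule image_eqI[of _ _ "[]"]) auto
    fix x assume "x \<in> ?N"
    then obtain xs where xs: "x = sum_list xs" "set xs \<subseteq> X" by blast
    show "- x \<in> ?N"
      using xs neg by (intro image_eqI[of _ _ "rev (map uminus xs)"])
        (auto simp only: sum_list_uminus_rev set_rev set_map mem_Collect_eq)
    fix y assume "y \<in> ?N"
    then obtain ys where "y = sum_list ys" "set ys \<subseteq> X" by blast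
    with xs show "x + y \<in> ?N" by (intro image_eqI[of _ _ "xs @ ys"]) auto
  qed
  moreover have "g + x + (- g) \<in> ?N" if "x \<in> ?N" for g x
  proof -
    from that obtain xs where "x = sum_list xs" "set xs \<subseteq> X" by blast
    then show ?thesis
      using conj by (intro image_eqI[of _ _ "map (\<lambda>x. g + x - g) xs"]) (auto simp: sum_list_conj)
  qed
  ultimately have "is_normal_subgroup ?N" by (simp add: is_normal_subgroup_def)
  with G finite_words[OF conj fin short] have "?N = {0}"
    unfolding no_finite_normal_def by blast
  moreover have "x \<in> ?N" using \<open>x \<in> X\<close> by (intro image_eqI[of _ _ "[x]"]) auto
  ultimately show ?thesis by blast
qed

section \<open>Conjugacy classes, the FC-centre and centralizers\<close>

definition conj_class :: "'a::group_add \<Rightarrow> 'a set" where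
  "conj_class x = range (\<lambda>g. g + x - g)"

definition fc_centre :: "'a::group_add set" where
  "fc_centre = {x. finite (conj_class x)}"

definition centralizer :: "'a::group_add set \<Rightarrow> 'a set" where
  "centralizer S = {g. \<forall>s\<in>S. g + s = s + g}"

lemma conj_conj: "g + (h + x - h) - g = (g + h) + x - (g + h::'a::group_add)"
  by (simp add: add.assoc minus_add diff_conv_add_uminus del: add_uminus_conv_diff)

lemma conj_class_closed: "y \<in> conj_class x \<Longrightarrow> g + y - g \<in> conj_class x"
  by (auto simp: conj_class_def conj_conj)

lemma self_in_conj_class: "x \<in> conj_class x"
  unfolding conj_class_def by (rule image_eqI[of _ _ 0]) auto

lemma conj_class_conj: "conj_class (g + x - g) \<subseteq> conj_class x"
  by (auto simp: conj_class_def conj_conj)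

lemma fc_centre_conj: "x \<in> fc_centre \<Longrightarrow> g + x - g \<in> fc_centre"
  unfolding fc_centre_def using conj_class_conj finite_subset by blast

lemma conj_class_uminus: "conj_class (- x) = uminus ` conj_class x"
  by (simp add: conj_class_def image_image minus_add diff_conv_add_uminus add.assoc
      del: add_uminus_conv_diff)

lemma subgroup_fc_centre: "is_subgroup fc_centre"
  unfolding is_subgroup_def
proof (intro conjI ballI)
  show "0 \<in> fc_centre" by (simp add: fc_centre_def conj_class_def)
  fix x :: 'a assume x: "x \<in> fc_centre"
  then show "- x \<in> fc_centre" by (simp add: fc_centre_def conj_class_uminus)
  fix y :: 'a assume y: "y \<in> fc_centre"
  have "conj_class (x + y) \<subseteq> (\<lambda>(u, v). u + v) ` (conj_class x \<times> conj_class y)"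
  proof
    fix z assume "z \<in> conj_class (x + y)"
    then obtain g where "z = g + (x + y) - g" by (auto simp: conj_class_def)
    then have "z = (g + x - g) + (g + y - g)"
      by (simp add: add.assoc diff_conv_add_uminus del: add_uminus_conv_diff)
    then show "z \<in> (\<lambda>(u, v). u + v) ` (conj_class x \<times> conj_class y)"
      by (auto simp: conj_class_def)
  qed
  with x y show "x + y \<in> fc_centre"
    unfolding fc_centre_def mem_Collect_eq by (meson finite_SigmaI finite_imageI finite_subset)
qed

lemma subgroup_centralizer: "is_subgroup (centralizer S)"
  unfolding is_subgroup_def centralizer_def
proof (intro conjI ballI CollectI)
  fix x y s assume x: "x \<in> {g. \<forall>s\<in>S. g + s = s + g}" and s: "s \<in> S"
  then have xs: "x + s = s + x" by blast
  have "- x + (x + s) + - x = - x + (s + x) + - x" by (simp only: xs)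
  then show "- x + s = s + - x"
    by (simp add: add.assoc diff_conv_add_uminus del: add_uminus_conv_diff)
  assume "y \<in> {g. \<forall>s\<in>S. g + s = s + g}"
  with s have "y + s = s + y" by blast
  with xs show "x + y + s = s + (x + y)" by (metis add.assoc)
qed simp

lemma centralizer_conj:
  assumes S: "\<And>g s. s \<in> S \<Longrightarrow> g + s - g \<in> S" and z: "z \<in> centralizer S"
  shows "g + z - g \<in> centralizer (S :: 'a::group_add set)"
  unfolding centralizer_def
proof (intro CollectI ballI)
  fix s assume "s \<in> S"
  then have "- g + s - (- g) \<in> S" by (rule S)
  with z have "z + (- g + s - (- g)) = (- g + s - (- g)) + z"
    by (auto simp: centralizer_def)
  then have "g + (z + (- g + s - (- g))) - g = g + ((- g + s - (- g)) + z) - g" by (simp only:)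
  then show "g + z - g + s = s + (g + z - g)"
    by (simp add: add.assoc diff_conv_add_uminus del: add_uminus_conv_diff)
qed

text \<open>The function \<open>\<rho>\<close> records the conjugation action on \<open>S\<close>; its finite range expresses
  that the centralizer of \<open>S\<close> has finite index.\<close>

lemma centralizer_finite_index:
  fixes S :: "'a::group_add set"
  assumes "finite S" "S \<subseteq> fc_centre"
  obtains \<rho> :: "'a \<Rightarrow> 'a \<Rightarrow> 'a"
  where "finite (range \<rho>)" "\<And>g h. \<rho> g = \<rho> h \<Longrightarrow> - h + g \<in> centralizer S"
proof
  let ?\<rho> = "\<lambda>g. restrict (\<lambda>s. g + s - g) S"
  have "range ?\<rho> \<subseteq> PiE S conj_class" by (auto simp: conj_class_def PiE_def)
  moreover have "finite (PiE S conj_class)"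
    using assms by (intro finite_PiE) (auto simp: fc_centre_def)
  ultimately show "finite (range ?\<rho>)" by (rule finite_subset)
  fix g h :: 'a assume eq: "?\<rho> g = ?\<rho> h"
  show "- h + g \<in> centralizer S"
    unfolding centralizer_def
  proof (intro CollectI ballI)
    fix s assume "s \<in> S"
    with fun_cong[OF eq, of s] have "g + s - g = h + s - h" by simp
    then have "- h + (g + s - g) + g = - h + (h + s - h) + g" by (simp only:)
    then show "- h + g + s = s + (- h + g)"
      by (simp add: add.assoc diff_conv_add_uminus del: add_uminus_conv_diff)
  qed
qed

text \<open>Since \<rho> has finite range, it agrees on two different multiples of \<open>c\<close>;
  their difference is a positive multiple of \<open>c\<close> in the centralizer.\<close>

lemma nmul_in_centralizer:
  fixes S :: "'a::group_add set"
  assumes "finite S" "S \<subseteq> fc_centre"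
  obtains n where "n > 0" "nmul n c \<in> centralizer S"
proof -
  obtain \<rho> :: "'a \<Rightarrow> 'a \<Rightarrow> 'a" where \<rho>: "finite (range \<rho>)"
    "\<And>g h. \<rho> g = \<rho> h \<Longrightarrow> - h + g \<in> centralizer S"
    using centralizer_finite_index[OF assms] by blast
  have "finite (range (\<lambda>k. \<rho> (nmul k c)))"
    using \<rho>(1) by (rule finite_subset[rotated]) auto
  then have "\<not> inj (\<lambda>k. \<rho> (nmul k c))"
    using finite_imageD infinite_UNIV_nat by blast
  then obtain i j where ij: "i < j" "\<rho> (nmul j c) = \<rho> (nmul i c)"
    unfolding inj_def by (metis linorder_neq_iff)
  have "- nmul i c + nmul j c = nmul (j - i) c"
    using nmul_add[of i "j - i" c] ij by simp
  with ij \<rho>(2)[of "nmul j c" "nmul i c"] that[of "j - i"] show thesis by simp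
qed

text \<open>Dietzmann's lemma applied to the conjugates of \<open>x\<close> and \<open>- x\<close>:
  \<open>n\<close> annihilates each of them, so \<open>n\<close> equal letters reduce to the empty
  word.\<close>

lemma fc_centre_torsion_free:
  fixes x :: "'a::group_add"
  assumes G: "no_finite_normal TYPE('a)" and x: "x \<in> fc_centre" and n: "n > 0" "nmul n x = 0"
  shows "x = 0"
proof -
  let ?X = "conj_class x \<union> conj_class (- x)"
  show ?thesis
  proof (rule no_finite_normal_trivial[OF G, where X = ?X])
    show "g + y - g \<in> ?X" if "y \<in> ?X" for g y
      using that conj_class_closed by blast
    show "- y \<in> ?X" if "y \<in> ?X" for y
      using that by (auto simp: conj_class_uminus)
    show "finite ?X"
      using x by (simp add: fc_centre_def conj_class_uminus)
    show "\<exists>n vs. set vs \<subseteq> ?X \<and> length vs < n \<and> nmul n y = sum_list vs" if y: "y \<in> ?X" for y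
    proof (intro exI conjI)
      show "set [] \<subseteq> ?X" "length [] < n" using n by auto
      obtain g where "y = g + x - g \<or> y = - (g + x - g)"
        using y unfolding conj_class_uminus unfolding conj_class_def by blast
      then have "nmul n y = 0" using n by (auto simp only: nmul_conj nmul_uminus) simp_all
      then show "nmul n y = sum_list []" by simp
    qed
    show "x \<in> ?X" using self_in_conj_class by blast
  qed
qed

section \<open>Commutators and commutativity of the FC-centre\<close>

definition commutator :: "'a::group_add \<Rightarrow> 'a \<Rightarrow> 'a" where
  "commutator g h = - g - h + g + h"

lemma commutator_conj: "k + commutator g h - k = commutator (k + g - k) (k + h - k)"
  by (simp add: commutator_def add.assoc minus_add diff_conv_add_uminus del: add_uminus_conv_diff)

lemma commutator_uminus: "- commutator g h = commutator h g"
  by (simp add: commutator_def add.assoc minus_add diff_conv_add_uminus del: add_uminus_conv_diff)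

lemma commutator_eq_0_iff: "commutator g h = 0 \<longleftrightarrow> g + h = h + g"
proof -
  have "commutator g h = - (h + g) + (g + h)"
    by (simp add: commutator_def minus_add add.assoc diff_conv_add_uminus del: add_uminus_conv_diff)
  then show ?thesis by (metis add.left_inverse add_left_cancel)
qed

text \<open>Together with its right-hand version, this makes commutators depend only on the classes
  of their arguments modulo central elements, so finite index leaves finitely many of them.\<close>

lemma commutator_central_left:
  assumes "z + g = g + z" "z + h = h + z"
  shows "commutator (g + z) h = commutator g h"
proof -
  have "g + z + h = g + h + z" using assms by (simp add: add.assoc)
  then have 1: "- (h + (g + z)) + (g + z + h) = - (h + g + z) + (g + h + z)"
    by (simp add: add.assoc)
  have zc: "z + - (h + g) + (g + h) = - (h + g) + (g + h) + z"
  proof -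
    have "is_subgroup (centralizer {z})" by (rule subgroup_centralizer)
    moreover have "g \<in> centralizer {z}" "h \<in> centralizer {z}"
      using assms by (simp_all add: centralizer_def)
    ultimately have "- (h + g) + (g + h) \<in> centralizer {z}"
      by (simp add: is_subgroup_def)
    then show ?thesis
      by (simp add: centralizer_def add.assoc diff_conv_add_uminus del: add_uminus_conv_diff)
  qed
  have "commutator (g + z) h = - z + (- (h + g) + (g + h) + z)"
    using 1 by (simp add: commutator_def minus_add add.assoc diff_conv_add_uminus
        del: add_uminus_conv_diff)
  also have "\<dots> = - (h + g) + (g + h)"
    by (simp only: zc[symmetric])
      (simp add: add.assoc diff_conv_add_uminus del: add_uminus_conv_diff)
  also have "\<dots> = commutator g h"
    by (simp add: commutator_def minus_add add.assoc diff_conv_add_uminus del: add_uminus_conv_diff)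
  finally show ?thesis .
qed

lemma commutator_central_right:
  assumes "z + g = g + z" "z + h = h + z"
  shows "commutator g (h + z) = commutator g h"
  using commutator_central_left[OF assms(2,1)] commutator_uminus by metis

text \<open>Schur's identity. Once \<open>n + 1\<close> copies of the commutator commute with
  \<open>h\<close>, a product of \<open>n + 2\<close> commutators becomes a product of
  \<open>n + 1\<close>: one copy of \<open>h\<close> is moved across to form \<open>h + h\<close>,
  and \<open>n\<close> copies get conjugated.\<close>

lemma nmul_commutator:
  assumes "nmul (Suc n) (commutator g h) + h = h + nmul (Suc n) (commutator g h)"
  shows "nmul (Suc (Suc n)) (commutator g h) =
    commutator g (h + h) + nmul n (- h + commutator g h - (- h))"
proof -
  let ?c = "commutator g h"
  have "nmul (Suc (Suc n)) ?c = - g - h + g + (h + nmul (Suc n) ?c)"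
    by (simp add: commutator_def add.assoc)
  also have "\<dots> = - g - h + g + (nmul (Suc n) ?c + h)"
    by (simp only: assms)
  also have "\<dots> = - g - h + g + (?c + nmul n ?c + h)"
    by simp
  also have "\<dots> = commutator g (h + h) + (- h + nmul n ?c - (- h))"
    by (simp add: commutator_def add.assoc minus_add diff_conv_add_uminus del: add_uminus_conv_diff)
  finally show ?thesis by (simp only: nmul_conj)
qed

text \<open>Instead of the subgroup generated by the conjugates of \<open>x\<close> and \<open>y\<close> the proof uses its
  double centralizer, which has the same centralizer. By Schur's argument the commutators of
  elements of that group generate a finite normal subgroup.\<close>

lemma fc_centre_commute:
  fixes x y :: "'a::group_add"
  assumes G: "no_finite_normal TYPE('a)" and x: "x \<in> fc_centre" and y: "y \<in> fc_centre"
  shows "x + y = y + x"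
proof -
  define S where "S = conj_class x \<union> conj_class y"
  have S_fin: "finite S" using x y by (simp add: S_def fc_centre_def)
  have S_fc: "S \<subseteq> fc_centre"
    using x y by (auto simp: S_def conj_class_def fc_centre_conj)
  have S_conj: "g + s - g \<in> S" if "s \<in> S" for g s
    using that conj_class_closed unfolding S_def by blast
  define H where "H = centralizer (centralizer S)"
  have H_sub: "is_subgroup H" unfolding H_def by (rule subgroup_centralizer)
  have H_conj: "g + h - g \<in> H" if "h \<in> H" for g h
    using centralizer_conj[OF centralizer_conj[OF S_conj]] that unfolding H_def by blast
  have "S \<subseteq> H" by (auto simp: H_def centralizer_def)
  then have xyH: "x \<in> H" "y \<in> H" using self_in_conj_class by (auto simp: S_def)
  have zH: "z + h = h + z" if "z \<in> centralizer S" "h \<in> H" for z h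
    using that by (simp add: H_def centralizer_def[of "centralizer S"])
  obtain \<rho> :: "'a \<Rightarrow> 'a \<Rightarrow> 'a" where \<rho>: "finite (range \<rho>)"
    "\<And>g h. \<rho> g = \<rho> h \<Longrightarrow> - h + g \<in> centralizer S"
    using centralizer_finite_index[OF S_fin S_fc] by blast
  define X where "X = (\<lambda>(g, h). commutator g h) ` (H \<times> H)"
  \<comment> \<open>Equal values of \<rho> differ by an element of \<open>centralizer S\<close>,
    which commutes with all of \<open>H\<close>. So on \<open>H\<close> a commutator is determined
    by two values of \<rho>.\<close>
  have eq: "commutator g h = commutator g' h'"
    if "g \<in> H" "h \<in> H" "g' \<in> H" "h' \<in> H" "\<rho> g = \<rho> g'" "\<rho> h = \<rho> h'" for g h g' h'
  proof -
    have "commutator (g' + (- g' + g)) h = commutator g' h"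
      using that by (intro commutator_central_left zH \<rho>(2)) auto
    moreover have "commutator g' (h' + (- h' + h)) = commutator g' h'"
      using that by (intro commutator_central_right zH \<rho>(2)) auto
    ultimately show ?thesis by (simp add: add.assoc[symmetric])
  qed
  \<comment> \<open>\<open>SOME\<close> picks a representative in \<open>H\<close> of each value of
    \<rho>. Values not attained on \<open>H\<close> only enlarge the finite set on the
    right.\<close>
  have "X \<subseteq> (\<lambda>(r, s). commutator (SOME g. g \<in> H \<and> \<rho> g = r) (SOME h. h \<in> H \<and> \<rho> h = s))
      ` (range \<rho> \<times> range \<rho>)"
  proof
    fix c assume "c \<in> X"
    then obtain g h where gh: "g \<in> H" "h \<in> H" "c = commutator g h" by (auto simp: X_def)
    have s: "(SOME k'. k' \<in> H \<and> \<rho> k' = \<rho> k) \<in> H \<and> \<rho> (SOME k'. k' \<in> H \<and> \<rho> k' = \<rho> k) = \<rho> k"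
      if "k \<in> H" for k
      by (rule someI[of "\<lambda>k'. k' \<in> H \<and> \<rho> k' = \<rho> k" k]) (use that in simp)
    have "c = commutator (SOME k. k \<in> H \<and> \<rho> k = \<rho> g) (SOME k. k \<in> H \<and> \<rho> k = \<rho> h)"
      unfolding gh(3) using s gh by (intro eq) auto
    then show "c \<in> (\<lambda>(r, s). commutator (SOME g. g \<in> H \<and> \<rho> g = r) (SOME h. h \<in> H \<and> \<rho> h = s))
      ` (range \<rho> \<times> range \<rho>)" by auto
  qed
  then have X_fin: "finite X" using \<rho>(1) finite_subset by blast
  have X_conj: "k + c - k \<in> X" if c: "c \<in> X" for k c
  proof -
    from c obtain g h where "g \<in> H" "h \<in> H" "c = commutator g h" by (auto simp: X_def)
    then have "k + g - k \<in> H" "k + h - k \<in> H"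
      "k + c - k = commutator (k + g - k) (k + h - k)"
      using H_conj by (auto simp: commutator_conj)
    then show ?thesis by (auto simp: X_def)
  qed
  have "commutator x y = 0"
  proof (rule no_finite_normal_trivial[OF G X_conj _ X_fin])
    show "- c \<in> X" if "c \<in> X" for c
      using that by (auto simp: X_def commutator_uminus)
    show "commutator x y \<in> X" using xyH by (auto simp: X_def)
    fix c assume c: "c \<in> X"
    then obtain g h where gh: "g \<in> H" "h \<in> H" "c = commutator g h" by (auto simp: X_def)
    obtain n where n: "n > 0" "nmul n c \<in> centralizer S"
      using nmul_in_centralizer[OF S_fin S_fc] by blast
    then obtain m where m: "n = Suc m" by (cases n) auto
    \<comment> \<open>This word has \<open>1 + m = n\<close> letters, one fewer than the
      \<open>Suc n\<close> copies of \<open>c\<close> that it replaces.\<close>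
    let ?vs = "commutator g (h + h) # replicate m (- h + c - (- h))"
    have "h + h \<in> H" using H_sub gh by (simp add: is_subgroup_def)
    then have "set ?vs \<subseteq> X" using X_conj[OF c, of "- h"] gh(1) by (auto simp: X_def)
    moreover have "nmul (Suc n) c = sum_list ?vs"
      using nmul_commutator[of m g h] zH[OF n(2) gh(2)] gh(3) m by simp
    moreover have "length ?vs < Suc n" using m by simp
    ultimately show "\<exists>n vs. set vs \<subseteq> X \<and> length vs < n \<and> nmul n c = sum_list vs" by blast
  qed
  then show ?thesis by (simp add: commutator_eq_0_iff)
qed

section \<open>Unique products in torsion-free abelian groups\<close>

text \<open>A maximal subsemigroup without \<open>0\<close> is the positive cone of a total order.\<close>

lemma positive_cone:
  fixes D :: "'a::group_add set"
  assumes D: "is_subgroup D"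
    and comm: "\<And>x y. x \<in> D \<Longrightarrow> y \<in> D \<Longrightarrow> x + y = y + x"
    and tf: "\<And>n x. x \<in> D \<Longrightarrow> n > 0 \<Longrightarrow> nmul n x = 0 \<Longrightarrow> x = 0"
  obtains P where "P \<subseteq> D" "0 \<notin> P" "\<And>x y. x \<in> P \<Longrightarrow> y \<in> P \<Longrightarrow> x + y \<in> P"
    "\<And>x. x \<in> D \<Longrightarrow> x \<noteq> 0 \<Longrightarrow> x \<in> P \<or> - x \<in> P"
proof -
  have D0: "0 \<in> D" and Dadd: "\<And>x y. x \<in> D \<Longrightarrow> y \<in> D \<Longrightarrow> x + y \<in> D"
    and Dneg: "\<And>x. x \<in> D \<Longrightarrow> - x \<in> D"
    using D by (auto simp: is_subgroup_def)
  have Dn: "nmul n x \<in> D" if "x \<in> D" for n x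
    using that by (induction n) (auto simp: D0 Dadd)
  \<comment> \<open>The empty set belongs to \<open>F\<close>, so the empty chain in Zorn's lemma is
    covered too.\<close>
  define F where "F = {P. P \<subseteq> D \<and> 0 \<notin> P \<and> (\<forall>x\<in>P. \<forall>y\<in>P. x + y \<in> P)}"
  have "\<exists>M\<in>F. \<forall>X\<in>F. M \<subseteq> X \<longrightarrow> X = M"
  proof (rule subset_Zorn')
    fix C assume C: "subset.chain F C"
    then have CF: "C \<subseteq> F" and lin: "\<And>X Y. X \<in> C \<Longrightarrow> Y \<in> C \<Longrightarrow> X \<subseteq> Y \<or> Y \<subseteq> X"
      by (auto simp: subset_chain_def)
    have "x + y \<in> \<Union>C" if xy: "x \<in> \<Union>C" "y \<in> \<Union>C" for x y
    proof -
      from xy obtain X Y where XY: "X \<in> C" "Y \<in> C" "x \<in> X" "y \<in> Y" by blast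
      then obtain Z where "Z \<in> C" "x \<in> Z" "y \<in> Z" using lin by blast
      with CF show ?thesis unfolding F_def by blast
    qed
    then show "\<Union>C \<in> F" using CF unfolding F_def by blast
  qed
  then obtain P where PF: "P \<in> F" and max: "\<And>X. X \<in> F \<Longrightarrow> P \<subseteq> X \<Longrightarrow> X = P" by blast
  from PF have PD: "P \<subseteq> D" and P0: "0 \<notin> P" and Padd: "\<And>x y. x \<in> P \<Longrightarrow> y \<in> P \<Longrightarrow> x + y \<in> P"
    by (auto simp: F_def)
  have Pn: "nmul n x \<in> P" if "x \<in> P" "n > 0" for n x
    using that(2,1) by (induction n rule: nat_induct_non_zero) (auto simp: Padd)
  \<comment> \<open>By maximality, adjoining \<open>x\<close> to \<open>P\<close> must produce
    \<open>0 = p + nmul k x\<close>. Torsion-freeness excludes \<open>p = 0\<close>, so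
    \<open>p\<close> is in \<open>P\<close> and equals \<open>- nmul k x\<close>.\<close>
  have key: "\<exists>n>0. - nmul n x \<in> P" if x: "x \<in> D" "x \<noteq> 0" "x \<notin> P" for x
  proof -
    define P' where "P' = insert 0 P"
    have P'D: "p \<in> D" if "p \<in> P'" for p using that PD D0 by (auto simp: P'_def)
    have P'add: "p + q \<in> P'" if "p \<in> P'" "q \<in> P'" for p q
      using that Padd by (auto simp: P'_def)
    \<comment> \<open>The semigroup generated by \<open>P\<close> and \<open>x\<close>; taking
      \<open>p\<close> from \<open>P'\<close> admits the pure multiples of \<open>x\<close>.\<close>
    define Q where "Q = P \<union> {p + nmul k x |p k. p \<in> P' \<and> k > 0}"
    have swap: "(p + nmul k x) + (q + nmul l x) = (p + q) + nmul (k + l) x"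
      if "p \<in> P'" "q \<in> P'" for p q k l
    proof -
      have "nmul k x + q = q + nmul k x" using that x P'D Dn comm by blast
      then show ?thesis by (metis add.assoc nmul_add)
    qed
    have "Q \<subseteq> D" using PD P'D Dn Dadd x by (auto simp: Q_def)
    moreover have "u + v \<in> Q" if uv: "u \<in> Q" "v \<in> Q" for u v
    proof (cases "u \<in> P \<and> v \<in> P")
      case True
      then show ?thesis using Padd by (simp add: Q_def)
    next
      case False
      have "\<exists>p k. u = p + nmul k x \<and> p \<in> P' \<and> (k > 0 \<or> u \<in> P)" if "u \<in> Q" for u
        using that unfolding Q_def
      proof
        assume "u \<in> P"
        then show ?thesis by (intro exI[of _ u] exI[of _ 0]) (auto simp: P'_def)
      qed auto
      with uv obtain p k q l where
        "u = p + nmul k x" "p \<in> P'" "k > 0 \<or> u \<in> P"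
        "v = q + nmul l x" "q \<in> P'" "l > 0 \<or> v \<in> P" by metis
      moreover from this have "k + l > 0" using False by auto
      ultimately have "u + v = (p + q) + nmul (k + l) x" "p + q \<in> P'" "k + l > 0"
        using swap P'add by auto
      then show ?thesis unfolding Q_def by blast
    qed
    moreover have "x \<in> Q"
      unfolding Q_def by (rule UnI2, rule CollectI, rule exI[of _ 0], rule exI[of _ 1])
        (auto simp: P'_def)
    then have "Q \<noteq> P" using x by blast
    ultimately have "0 \<in> Q" using max[of Q] by (auto simp: F_def Q_def)
    then obtain p k where pk: "0 = p + nmul k x" "p \<in> P'" "k > 0" using P0 by (auto simp: Q_def)
    then have "p = - nmul k x" by (metis eq_neg_iff_add_eq_0)
    moreover have "p \<noteq> 0" using tf[OF x(1) pk(3)] x(2) pk(1) by auto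
    ultimately show ?thesis using pk by (auto simp: P'_def)
  qed
  have "x \<in> P \<or> - x \<in> P" if x: "x \<in> D" "x \<noteq> 0" for x
  proof (rule ccontr)
    assume no: "\<not> ?thesis"
    \<comment> \<open>The multiples for \<open>x\<close> and \<open>- x\<close> may differ. Passing
      to the common multiple \<open>n * m\<close> puts an element and its negative into
      \<open>P\<close>, and their sum is \<open>0\<close>.\<close>
    obtain m where m: "m > 0" "- nmul m x \<in> P" using key[of x] x no by blast
    obtain n where n: "n > 0" "nmul n x \<in> P"
      using key[of "- x"] x no Dneg by (auto simp: nmul_uminus)
    have "- nmul (n * m) x \<in> P" using Pn[OF m(2) n(1)] by (simp add: nmul_uminus nmul_nmul)
    moreover have "nmul (n * m) x \<in> P"
      using Pn[OF n(2) m(1)] by (simp add: nmul_nmul mult.commute)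
    ultimately have "- nmul (n * m) x + nmul (n * m) x \<in> P" by (rule Padd)
    with P0 show False by simp
  qed
  with PD P0 Padd that show thesis by blast
qed

text \<open>Order \<open>D\<close> by letting \<open>y\<close> be below \<open>x\<close> when
  \<open>x - y\<close> is in the positive cone. The pair consists of the largest elements of
  \<open>S\<close> and \<open>T\<close>: another pair with the same sum would be smaller in one
  entry and larger in the other.\<close>

lemma unique_product:
  fixes D :: "'a::group_add set"
  assumes D: "is_subgroup D"
    and comm: "\<And>x y. x \<in> D \<Longrightarrow> y \<in> D \<Longrightarrow> x + y = y + x"
    and tf: "\<And>n x. x \<in> D \<Longrightarrow> n > 0 \<Longrightarrow> nmul n x = 0 \<Longrightarrow> x = 0"
    and S: "finite S" "S \<noteq> {}" "S \<subseteq> D" and T: "finite T" "T \<noteq> {}" "T \<subseteq> D"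
  obtains p q where "p \<in> S" "q \<in> T"
    "\<And>p' q'. p' \<in> S \<Longrightarrow> q' \<in> T \<Longrightarrow> p' + q' = p + q \<Longrightarrow> p' = p \<and> q' = q"
proof -
  obtain P where P: "P \<subseteq> D" "0 \<notin> P" and Padd: "\<And>x y. x \<in> P \<Longrightarrow> y \<in> P \<Longrightarrow> x + y \<in> P"
    and tot: "\<And>x. x \<in> D \<Longrightarrow> x \<noteq> 0 \<Longrightarrow> x \<in> P \<or> - x \<in> P"
    by (rule positive_cone[OF D comm tf]; (assumption | rule that))
  have Ddiff: "x - y \<in> D" if "x \<in> D" "y \<in> D" for x y
  proof -
    have "x + - y \<in> D" using D that unfolding is_subgroup_def by blast
    then show ?thesis by simp
  qed
  have mx: "\<exists>p\<in>S. \<forall>p'\<in>S. p' = p \<or> p - p' \<in> P" if "finite S" "S \<noteq> {}" "S \<subseteq> D" for S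
    using that
  proof (induction rule: finite_ne_induct)
    case (insert s S)
    then obtain p where p: "p \<in> S" "\<And>p'. p' \<in> S \<Longrightarrow> p' = p \<or> p - p' \<in> P" by auto
    have "p - s \<in> P \<or> s - p \<in> P"
      using tot[OF Ddiff[of p s]] p insert by auto
    then show ?case
    proof
      assume "s - p \<in> P"
      moreover from this have "s - p' \<in> P" if "p - p' \<in> P" for p'
        using Padd[OF _ that, of "s - p"]
        by (simp add: add.assoc diff_conv_add_uminus del: add_uminus_conv_diff)
      ultimately show ?thesis using p by (intro bexI[of _ s]) auto
    qed (use p in auto)
  qed simp
  obtain p where p: "p \<in> S" "\<And>p'. p' \<in> S \<Longrightarrow> p' = p \<or> p - p' \<in> P" using mx[OF S] by blast
  obtain q where q: "q \<in> T" "\<And>q'. q' \<in> T \<Longrightarrow> q' = q \<or> q - q' \<in> P" using mx[OF T] by blast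
  show thesis
  proof (rule that[OF p(1) q(1)])
    fix p' q' assume a: "p' \<in> S" "q' \<in> T" "p' + q' = p + q"
    have "p' = p"
    proof (rule ccontr)
      assume ne: "p' \<noteq> p"
      then have pp: "p - p' \<in> P" using p a by blast
      have "q' = - p' + (p + q)" using a(3) by (metis minus_add_cancel)
      then have "q' - q = - p' + p" by (simp add: add.assoc diff_conv_add_uminus
          del: add_uminus_conv_diff)
      also have "\<dots> = p - p'"
        using comm[of p "- p'"] a p S D by (auto simp: is_subgroup_def subset_iff)
      finally have "q' - q \<in> P" using pp by simp
      moreover from this P have "q' \<noteq> q" by auto
      ultimately have "(q - q') + (q' - q) \<in> P" using q a Padd by blast
      then show False
        using P by (simp add: add.assoc diff_conv_add_uminus del: add_uminus_conv_diff)
    qed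
    with a show "p' = p \<and> q' = q" by simp
  qed
qed

section \<open>Coverings by cosets\<close>

text \<open>B. H. Neumann's covering lemma.\<close>

lemma coset_cover:
  fixes H :: "'i \<Rightarrow> 'a::group_add set"
  assumes "finite I" "\<And>i. i \<in> I \<Longrightarrow> is_subgroup (H i)" "\<And>i. i \<in> I \<Longrightarrow> finite (T i)"
    "\<And>x. \<exists>i\<in>I. \<exists>t\<in>T i. - t + x \<in> H i"
  shows "\<exists>i\<in>I. \<exists>T. finite T \<and> (\<forall>x. \<exists>t\<in>T. - t + x \<in> H i)"
  using assms
proof (induction arbitrary: T rule: finite_induct)
  case (insert j I)
  show ?case
  proof (cases "\<forall>x. \<exists>t\<in>T j. - t + x \<in> H j")
    case True
    then show ?thesis using insert.prems by blast
  next
    case False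
    then obtain g where g: "\<And>t. t \<in> T j \<Longrightarrow> - t + g \<notin> H j" by blast
    have Hj: "is_subgroup (H j)" using insert.prems by simp
    \<comment> \<open>The coset \<open>g + H j\<close> meets none of the listed cosets of
      \<open>H j\<close>, so cosets of the other subgroups cover it. Translating these by
      \<open>s - g\<close> covers \<open>s + H j\<close>, which makes \<open>H j\<close>
      dispensable.\<close>
    define T' where "T' i = T i \<union> (\<lambda>(s, t). s - g + t) ` (T j \<times> T i)" for i
    have "\<exists>i\<in>I. \<exists>t\<in>T' i. - t + x \<in> H i" for x
    proof (cases "\<exists>i\<in>I. \<exists>t\<in>T i. - t + x \<in> H i")
      case True
      then show ?thesis by (auto simp: T'_def)
    next
      case False
      then obtain s where s: "s \<in> T j" "- s + x \<in> H j" using insert.prems(3)[of x] by auto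
      define y where "y = g - s + x"
      have "- t + y \<notin> H j" if t: "t \<in> T j" for t
      proof
        assume "- t + y \<in> H j"
        then have "(- t + y) + - (- s + x) \<in> H j" using s Hj unfolding is_subgroup_def by blast
        moreover have "(- t + y) + - (- s + x) = - t + g"
          by (simp add: y_def add.assoc minus_add diff_conv_add_uminus del: add_uminus_conv_diff)
        ultimately show False using g[OF t] by simp
      qed
      then obtain i t where it: "i \<in> I" "t \<in> T i" "- t + y \<in> H i"
        using insert.prems(3)[of y] by auto
      have "- (s - g + t) + x = - t + y"
        by (simp add: y_def add.assoc minus_add diff_conv_add_uminus del: add_uminus_conv_diff)
      moreover have "s - g + t \<in> T' i" using s it by (auto simp: T'_def)
      ultimately show ?thesis using it by (intro bexI[of _ i] bexI[of _ "s - g + t"]) auto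
    qed
    moreover have "finite (T' i)" if "i \<in> I" for i
      using insert.prems that by (auto simp: T'_def)
    ultimately show ?thesis using insert.IH[of T'] insert.prems by blast
  qed
qed simp

text \<open>If no such \<open>x\<close> existed, finitely many cosets of the centralizers of single
  elements of \<open>V\<close> would cover the group. By Neumann's lemma one of these centralizers
  would have finite index, and its \<open>v\<close> would lie in the FC-centre.\<close>

lemma separating_element:
  fixes S :: "'a::group_add set"
  assumes S: "finite S" "S \<subseteq> fc_centre" and U: "finite U"
    and V: "finite V" "V \<inter> fc_centre = {}"
  obtains x where "x \<in> centralizer S" "\<And>v. v \<in> V \<Longrightarrow> x + v - x \<notin> U"
proof (rule ccontr)
  assume "\<not> thesis"
  with that have bad: "\<exists>v\<in>V. x + v - x \<in> U" if "x \<in> centralizer S" for x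
    using that by blast
  obtain \<rho> :: "'a \<Rightarrow> 'a \<Rightarrow> 'a" where \<rho>: "finite (range \<rho>)"
    "\<And>g h. \<rho> g = \<rho> h \<Longrightarrow> - h + g \<in> centralizer S"
    using centralizer_finite_index[OF S] by blast
  \<comment> \<open>\<open>inv \<rho> r\<close> represents a coset of \<open>centralizer S\<close>,
    and the chosen \<open>t\<close> conjugates \<open>v\<close> to \<open>u\<close>. All elements
    doing so lie in \<open>t + centralizer {v}\<close>. If no such \<open>t\<close> exists,
    \<open>SOME\<close> only adds a harmless representative.\<close>
  define T where "T v = (\<lambda>(r, u). inv \<rho> r + (SOME t. t + v - t = u)) ` (range \<rho> \<times> U)" for v
  have "\<exists>v\<in>V. \<exists>T. finite T \<and> (\<forall>x. \<exists>t\<in>T. - t + x \<in> centralizer {v})"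
  proof (rule coset_cover[OF V(1) subgroup_centralizer])
    show "finite (T v)" for v using \<rho>(1) U by (simp add: T_def)
    fix x
    let ?g = "inv \<rho> (\<rho> x)"
    have "- ?g + x \<in> centralizer S" by (rule \<rho>(2)) (simp add: f_inv_into_f)
    with bad obtain v where v: "v \<in> V" "(- ?g + x) + v - (- ?g + x) \<in> U" by blast
    let ?y = "- ?g + x" and ?t = "SOME t. t + v - t = (- ?g + x) + v - (- ?g + x)"
    have "?t + v - ?t = ?y + v - ?y" by (rule someI[of _ ?y]) simp
    then have "- ?t + (?t + v - ?t) + ?y = - ?t + (?y + v - ?y) + ?y" by (simp only:)
    then have "v + (- ?t + ?y) = (- ?t + ?y) + v"
      by (simp only: add.assoc diff_conv_add_uminus minus_add_cancel left_minus add_0_right)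
    then have "- (?g + ?t) + x \<in> centralizer {v}"
      by (simp add: centralizer_def minus_add add.assoc diff_conv_add_uminus
          del: add_uminus_conv_diff)
    moreover have "?g + ?t \<in> T v" using v unfolding T_def by force
    ultimately show "\<exists>v\<in>V. \<exists>t\<in>T v. - t + x \<in> centralizer {v}" using v by blast
  qed
  then obtain v T where v: "v \<in> V" "finite T" "\<And>x. \<exists>t\<in>T. - t + x \<in> centralizer {v}" by blast
  have "conj_class v \<subseteq> (\<lambda>t. t + v - t) ` T"
  proof
    fix c assume "c \<in> conj_class v"
    then obtain x where x: "c = x + v - x" by (auto simp: conj_class_def)
    obtain t where t: "t \<in> T" "- t + x \<in> centralizer {v}" using v(3) by blast
    then have "(- t + x) + v = v + (- t + x)" by (simp add: centralizer_def)
    then have "t + ((- t + x) + v) - x = t + (v + (- t + x)) - x" by (simp only:)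
    then have "x + v - x = t + v - t"
      by (simp add: add.assoc diff_conv_add_uminus del: add_uminus_conv_diff)
    with x t show "c \<in> (\<lambda>t. t + v - t) ` T" by blast
  qed
  then have "v \<in> fc_centre" using v(2) finite_subset unfolding fc_centre_def by blast
  with V v show False by blast
qed

section \<open>Prime rings and group rings\<close>

lemma ideal_mult_zero_iff: "ideal_mult A B = {0} \<longleftrightarrow> (\<forall>a\<in>A. \<forall>b\<in>B. a * b = 0)"
proof
  assume z: "ideal_mult A B = {0}"
  show "\<forall>a\<in>A. \<forall>b\<in>B. a * b = 0"
  proof (intro ballI)
    fix a b assume "a \<in> A" "b \<in> B"
    then have "a * b \<in> ideal_mult A B"
      unfolding ideal_mult_def
      by (intro CollectI exI[of _ 1] exI[of _ "\<lambda>_. a"] exI[of _ "\<lambda>_. b"]) auto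
    with z show "a * b = 0" by simp
  qed
next
  assume "\<forall>a\<in>A. \<forall>b\<in>B. a * b = 0"
  moreover have "0 \<in> ideal_mult A B"
    unfolding ideal_mult_def by (intro CollectI exI[of _ 0]) auto
  ultimately show "ideal_mult A B = {0}" by (force simp: ideal_mult_def)
qed

lemma prime_ring_iff:
  "prime_ring TYPE('r::ring) \<longleftrightarrow> (\<exists>r::'r. r \<noteq> 0) \<and>
     (\<forall>A B :: 'r set. is_ideal A \<longrightarrow> is_ideal B \<longrightarrow> (\<forall>a\<in>A. \<forall>b\<in>B. a * b = 0) \<longrightarrow>
       A = {0} \<or> B = {0})"
  unfolding prime_ring_def ideal_mult_zero_iff by auto

text \<open>Primeness in terms of elements. If all \<open>a * r * b\<close> vanish, the annihilator
  ideals \<open>A\<close> and \<open>B\<close> contain \<open>a\<close> and \<open>b\<close>; they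
  replace the ideals generated by these elements.\<close>

lemma prime_ring_elements:
  fixes a b :: "'r::ring"
  assumes su: "s_unital TYPE('r)" and prime: "prime_ring TYPE('r)" and ab: "a \<noteq> 0" "b \<noteq> 0"
  obtains r where "a * r * b \<noteq> 0"
proof (rule ccontr)
  assume "\<not> thesis"
  with that have z: "a * r * b = 0" for r by blast
  define A where "A = {c. \<forall>r. c * r * b = 0}"
  define B where "B = {d. \<forall>c\<in>A. \<forall>r. c * r * d = 0}"
  have "is_ideal A"
    by (auto simp: is_ideal_def is_subgroup_def A_def algebra_simps)
      (metis mult.assoc mult_zero_right)+
  moreover have "is_ideal B"
    by (auto simp: is_ideal_def is_subgroup_def B_def algebra_simps)
      (metis mult.assoc mult_zero_left)+
  moreover have "c * d = 0" if "c \<in> A" "d \<in> B" for c d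
  proof -
    \<comment> \<open>Here \<open>s\<close>-unitality supplies the middle factor that the definition
      of \<open>B\<close> requires.\<close>
    obtain e where "c = c * e" using su unfolding s_unital_def by blast
    moreover have "c * e * d = 0" using that by (simp add: B_def)
    ultimately show ?thesis by simp
  qed
  ultimately have "A = {0} \<or> B = {0}" using prime unfolding prime_ring_iff by blast
  moreover have "a \<in> A" "b \<in> B" using z by (auto simp: A_def B_def)
  ultimately show False using ab by blast
qed

section \<open>Coefficients in the group ring and the two implications\<close>

abbreviation lookup :: "('g \<Rightarrow>\<^sub>0 'r::zero) \<Rightarrow> 'g \<Rightarrow> 'r" where
  "lookup \<equiv> Poly_Mapping.lookup"

abbreviation keys :: "('g \<Rightarrow>\<^sub>0 'r::zero) \<Rightarrow> 'g set" where
  "keys \<equiv> Poly_Mapping.keys"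

lemma lookup_nonzero: "f \<noteq> 0 \<Longrightarrow> \<exists>x. lookup f x \<noteq> 0"
  by (auto simp: poly_mapping_eq_iff fun_eq_iff)

lemma single_nonzero: "r \<noteq> 0 \<Longrightarrow> Poly_Mapping.single x r \<noteq> 0"
  by (metis lookup_single_eq lookup_zero)

lemma lookup_mult_left:
  fixes f g :: "'g::group_add \<Rightarrow>\<^sub>0 'r::ring"
  shows "lookup (f * g) k = (\<Sum>x\<in>keys f. lookup f x * lookup g (- x + k))"
proof -
  have eq: "k = l + q \<longleftrightarrow> q = - l + k" for l q
    by auto
  have "lookup (f * g) k = Sum_any (\<lambda>l. lookup f l * lookup g (- l + k))"
    by (simp only: lookup_mult eq Sum_any_when_equal)
  also have "\<dots> = (\<Sum>x\<in>keys f. lookup f x * lookup g (- x + k))"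
    by (rule Sum_any.expand_superset) (auto simp: in_keys_iff)
  finally show ?thesis .
qed

lemma lookup_mult_right:
  fixes f g :: "'g::group_add \<Rightarrow>\<^sub>0 'r::ring"
  shows "lookup (f * g) k = (\<Sum>y\<in>keys g. lookup f (k - y) * lookup g y)"
proof -
  let ?h = "\<lambda>x. lookup f x * lookup g (- x + k)"
  \<comment> \<open>Passing through the union of both index sets adds only zero terms; the
    substitution \<open>x = k - y\<close> then turns the sum over \<open>keys f\<close> into one
    over \<open>keys g\<close>.\<close>
  have "(\<Sum>x\<in>keys f. ?h x) = (\<Sum>x\<in>keys f \<union> (\<lambda>y. k - y) ` keys g. ?h x)"
    by (rule sum.mono_neutral_left) (auto simp: in_keys_iff)
  also have "\<dots> = (\<Sum>x\<in>(\<lambda>y. k - y) ` keys g. ?h x)"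
  proof (rule sum.mono_neutral_right)
    have "x = k - (- x + k)" for x by (simp add: diff_conv_add_uminus minus_add
        del: add_uminus_conv_diff)
    then show "\<forall>x\<in>(keys f \<union> (\<lambda>y. k - y) ` keys g) - (\<lambda>y. k - y) ` keys g. ?h x = 0"
      by (metis DiffD2 image_eqI in_keys_iff mult_zero_right)
  qed auto
  also have "\<dots> = (\<Sum>y\<in>keys g. lookup f (k - y) * lookup g y)"
  proof (subst sum.reindex)
    show "inj_on (\<lambda>y. k - y) (keys g)"
      by (auto simp: inj_on_def diff_conv_add_uminus simp del: add_uminus_conv_diff)
  qed simp
  finally show ?thesis by (simp add: lookup_mult_left)
qed

lemma lookup_mult_single:
  fixes f :: "'g::group_add \<Rightarrow>\<^sub>0 'r::ring"
  shows "lookup (f * Poly_Mapping.single x r) k = lookup f (k - x) * r"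
  by (cases "r = 0") (simp_all add: lookup_mult_right)

text \<open>An ideal \<open>A\<close> of the coefficient ring yields the ideal \<open>L A\<close> of
  elements with all coefficients in \<open>A\<close>. Annihilation carries over coefficientwise, and
  elements supported at \<open>0\<close> recover \<open>A\<close>.\<close>

lemma prime_coefficient_ring:
  assumes "prime_ring TYPE('g::group_add \<Rightarrow>\<^sub>0 'r::ring)"
  shows "prime_ring TYPE('r)"
  unfolding prime_ring_iff
proof (intro conjI allI impI)
  obtain f :: "'g \<Rightarrow>\<^sub>0 'r" where "f \<noteq> 0" using assms unfolding prime_ring_iff by blast
  then show "\<exists>r::'r. r \<noteq> 0" using lookup_nonzero by blast
  define L where "L A = {f :: 'g \<Rightarrow>\<^sub>0 'r. \<forall>x. lookup f x \<in> A}" for A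
  have sum_in: "(\<Sum>x\<in>K. h x) \<in> A" if "is_ideal A" "\<And>x. h x \<in> A" 
    for A :: "'r set" and h :: "'g \<Rightarrow> 'r" and K
    using that by (induction K rule: infinite_finite_induct) (auto simp: is_ideal_def is_subgroup_def)
  have L_ideal: "is_ideal (L A)" if A: "is_ideal A" for A
    unfolding is_ideal_def
  proof (intro conjI allI ballI)
    show "is_subgroup (L A)"
      using A by (auto simp: L_def is_ideal_def is_subgroup_def lookup_add)
    fix f a assume a: "a \<in> L A"
    show "f * a \<in> L A"
      unfolding L_def mem_Collect_eq lookup_mult_left
      by (intro allI sum_in[OF A]) (use A a in \<open>auto simp: L_def is_ideal_def\<close>)
    show "a * f \<in> L A"
      unfolding L_def mem_Collect_eq lookup_mult_left
      by (intro allI sum_in[OF A]) (use A a in \<open>auto simp: L_def is_ideal_def\<close>)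
  qed
  have L_zero: "A = {0}" if "is_ideal A" "L A = {0}" for A
  proof -
    have "a = 0" if a: "a \<in> A" for a
    proof -
      have "Poly_Mapping.single 0 a \<in> L A"
        using a \<open>is_ideal A\<close> by (auto simp: L_def lookup_single when_def is_ideal_def is_subgroup_def)
      with \<open>L A = {0}\<close> have "Poly_Mapping.single (0::'g) a = 0" by blast
      then show ?thesis using single_nonzero[of a "0 :: 'g"] by blast
    qed
    then show ?thesis using \<open>is_ideal A\<close> by (auto simp: is_ideal_def is_subgroup_def)
  qed
  fix A B :: "'r set"
  assume AB: "is_ideal A" "is_ideal B" "\<forall>a\<in>A. \<forall>b\<in>B. a * b = 0"
  have "\<forall>f\<in>L A. \<forall>g\<in>L B. f * g = 0"
    using AB(3) by (auto simp: L_def lookup_mult_left intro!: poly_mapping_eqI)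
  then have "L A = {0} \<or> L B = {0}"
    using assms L_ideal AB unfolding prime_ring_iff by blast
  then show "A = {0} \<or> B = {0}" using L_zero AB by blast
qed

text \<open>The right annihilator of the \<open>N\<close>-invariant elements contains \<open>r \<delta>\<^sub>0 - r \<delta>\<^sub>n\<close> for
  \<open>n \<in> N\<close>.\<close>

lemma prime_group_ring_no_finite_normal:
  assumes prime: "prime_ring TYPE('g::group_add \<Rightarrow>\<^sub>0 'r::ring)"
  shows "no_finite_normal TYPE('g)"
  unfolding no_finite_normal_def
proof
  assume "\<exists>N :: 'g set. is_normal_subgroup N \<and> finite N \<and> N \<noteq> {0}"
  then obtain N :: "'g set" where N: "is_normal_subgroup N" "finite N" "N \<noteq> {0}" by blast
  then have sub: "is_subgroup N" and conj: "\<And>g n. n \<in> N \<Longrightarrow> g + n - g \<in> N"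
    by (auto simp: is_normal_subgroup_def)
  then have N0: "0 \<in> N" and Nadd: "\<And>x y. x \<in> N \<Longrightarrow> y \<in> N \<Longrightarrow> x + y \<in> N"
    and Nneg: "\<And>x. x \<in> N \<Longrightarrow> - x \<in> N" by (auto simp: is_subgroup_def)
  obtain n where n: "n \<in> N" "n \<noteq> 0" using N N0 by auto
  obtain r :: 'r where r: "r \<noteq> 0"
    using prime_coefficient_ring[OF prime] unfolding prime_ring_iff by blast
  define A where "A = {f :: 'g \<Rightarrow>\<^sub>0 'r. \<forall>x. \<forall>m\<in>N. lookup f (x + m) = lookup f x}"
  define B where "B = {g :: 'g \<Rightarrow>\<^sub>0 'r. \<forall>f\<in>A. f * g = 0}"
  have A: "is_ideal A"
    unfolding is_ideal_def
  proof (intro conjI allI ballI)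
    show "is_subgroup A" by (auto simp: A_def is_subgroup_def lookup_add)
    fix f a assume a: "a \<in> A"
    show "f * a \<in> A"
      using a by (auto simp: A_def lookup_mult_left add.assoc[symmetric])
    \<comment> \<open>Normality is what makes \<open>A\<close> closed under right multiplication:
      moving \<open>m\<close> past \<open>- y\<close> turns it into the conjugate
      \<open>y + m - y\<close>, still in \<open>N\<close>.\<close>
    have "lookup a (x + m - y) = lookup a (x - y)" if m: "m \<in> N" for x m y
    proof -
      have "x + m - y = (x - y) + (y + m - y)"
        by (simp add: add.assoc diff_conv_add_uminus del: add_uminus_conv_diff)
      with a conj[OF m, of y] show ?thesis by (auto simp: A_def)
    qed
    then show "a * f \<in> A" by (simp add: A_def lookup_mult_right)
  qed
  have B: "is_ideal B"
    unfolding is_ideal_def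
  proof (intro conjI allI ballI)
    show "is_subgroup B" by (auto simp: B_def is_subgroup_def distrib_left)
    fix f b assume b: "b \<in> B"
    show "f * b \<in> B" using b A by (auto simp: B_def is_ideal_def mult.assoc[symmetric])
    show "b * f \<in> B" using b by (auto simp: B_def mult.assoc[symmetric])
  qed
  have "\<forall>f\<in>A. \<forall>g\<in>B. f * g = 0" by (simp add: B_def)
  with prime A B have "A = {0} \<or> B = {0}" unfolding prime_ring_iff by blast
  moreover have "A \<noteq> {0}"
  proof -
    \<comment> \<open>The function with constant value \<open>r\<close> on \<open>N\<close>,
      finitely supported because \<open>N\<close> is finite.\<close>
    let ?f = "\<Sum>m\<in>N. Poly_Mapping.single m r"
    have f: "lookup ?f x = (if x \<in> N then r else 0)" for x
      using N(2) by (simp add: lookup_sum lookup_single when_def)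
    have "x + m \<in> N \<longleftrightarrow> x \<in> N" if "m \<in> N" for x m
      using Nadd[OF _ that, of x] Nadd[OF _ Nneg[OF that], of "x + m"] by (auto simp: add.assoc)
    then have "?f \<in> A" by (simp add: A_def f)
    moreover have "?f \<noteq> 0" using f[of 0] N0 r by (metis lookup_zero)
    ultimately show ?thesis by blast
  qed
  moreover have "B \<noteq> {0}"
  proof -
    let ?g = "Poly_Mapping.single 0 r - Poly_Mapping.single n r"
    have "f * ?g = 0" if "f \<in> A" for f
    proof (rule poly_mapping_eqI)
      fix k
      have "lookup f (k + - n) = lookup f k" using that Nneg[OF n(1)] by (simp only: A_def) blast
      then show "lookup (f * ?g) k = lookup 0 k"
        by (simp add: right_diff_distrib lookup_minus lookup_mult_single)
    qed
    then have "?g \<in> B" by (simp add: B_def)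
    moreover have "lookup ?g 0 \<noteq> 0" using r n by (simp add: lookup_minus lookup_single when_def)
    then have "?g \<noteq> 0" by (metis lookup_zero)
    ultimately show ?thesis by blast
  qed
  ultimately show False by blast
qed

text \<open>A right translation moves a support point to \<open>0\<close>. The coefficient there
  survives because the translating element carries a local right unit \<open>e\<close> for
  it.\<close>

lemma ideal_translate:
  fixes A :: "('g::group_add \<Rightarrow>\<^sub>0 'r::ring) set"
  assumes su: "s_unital TYPE('r)" and A: "is_ideal A" "A \<noteq> {0}"
  obtains a where "a \<in> A" "lookup a 0 \<noteq> 0"
proof -
  obtain f where f: "f \<in> A" "f \<noteq> 0" using A by (auto simp: is_ideal_def is_subgroup_def)
  then obtain x where x: "lookup f x \<noteq> 0" using lookup_nonzero by blast
  obtain e where "lookup f x = lookup f x * e" using su unfolding s_unital_def by blast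
  then have "lookup (f * Poly_Mapping.single (- x) e) 0 \<noteq> 0"
    using x by (simp add: lookup_mult_single)
  moreover have "f * Poly_Mapping.single (- x) e \<in> A" using A f by (auto simp: is_ideal_def)
  ultimately show thesis using that by blast
qed

lemma prime_group_ring:
  assumes su: "s_unital TYPE('r::ring)" and prime: "prime_ring TYPE('r)"
    and G: "no_finite_normal TYPE('g::group_add)"
  shows "prime_ring TYPE('g \<Rightarrow>\<^sub>0 'r)"
  unfolding prime_ring_iff
proof (intro conjI allI impI)
  obtain r :: 'r where "r \<noteq> 0" using prime unfolding prime_ring_iff by blast
  then show "\<exists>f :: 'g \<Rightarrow>\<^sub>0 'r. f \<noteq> 0"
    by (intro exI[of _ "Poly_Mapping.single 0 r"] single_nonzero)
  fix A B :: "('g \<Rightarrow>\<^sub>0 'r) set"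
  assume A: "is_ideal A" and B: "is_ideal B" and AB: "\<forall>a\<in>A. \<forall>b\<in>B. a * b = 0"
  show "A = {0} \<or> B = {0}"
  proof (rule ccontr)
    assume nz: "\<not> ?thesis"
    \<comment> \<open>A non-zero coefficient at \<open>0\<close> guarantees that the support meets
      the FC-centre.\<close>
    obtain a where a: "a \<in> A" "lookup a 0 \<noteq> 0" using ideal_translate[OF su A] nz by blast
    obtain b where b: "b \<in> B" "lookup b 0 \<noteq> 0" using ideal_translate[OF su B] nz by blast
    let ?D = "fc_centre :: 'g set"
    have D0: "0 \<in> ?D" and Dadd: "\<And>x y. x \<in> ?D \<Longrightarrow> y \<in> ?D \<Longrightarrow> x + y \<in> ?D"
      and Dneg: "\<And>x. x \<in> ?D \<Longrightarrow> - x \<in> ?D"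
      using subgroup_fc_centre[where 'a = 'g] by (auto simp: is_subgroup_def)
    let ?S = "keys a \<inter> ?D" and ?T = "keys b \<inter> ?D"
    have "0 \<in> ?S" "0 \<in> ?T" using a b D0 by (auto simp: in_keys_iff)
    then have ne: "?S \<noteq> {}" "?T \<noteq> {}" by blast+
    have fin: "finite ?S" "?S \<subseteq> ?D" "finite ?T" "?T \<subseteq> ?D" by simp_all
    obtain p q where pq: "p \<in> ?S" "q \<in> ?T"
      and uniq: "\<And>p' q'. p' \<in> ?S \<Longrightarrow> q' \<in> ?T \<Longrightarrow> p' + q' = p + q \<Longrightarrow> p' = p \<and> q' = q"
      by (rule unique_product[OF subgroup_fc_centre fc_centre_commute[OF G]
          fc_centre_torsion_free[OF G] fin(1) ne(1) fin(2,3) ne(2) fin(4)];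
          (assumption | rule that))
    have "lookup a p \<noteq> 0" "lookup b q \<noteq> 0" using pq by (auto simp: in_keys_iff)
    then obtain r where r: "lookup a p * r * lookup b q \<noteq> 0"
      using prime_ring_elements[OF su prime] by blast
    \<comment> \<open>The forbidden values of \<open>x + v - x\<close> are those for which some
      \<open>u\<close> in the support of \<open>a\<close> satisfies
      \<open>u + (x + v - x) = p + q\<close>, that is, contributes at
      \<open>p + q + x\<close>.\<close>
    obtain x where x: "x \<in> centralizer ?T"
      and sep: "\<And>v. v \<in> keys b - ?D \<Longrightarrow> x + v - x \<notin> (\<lambda>u. - u + (p + q)) ` keys a"
      by (rule separating_element[of ?T "(\<lambda>u. - u + (p + q)) ` keys a" "keys b - ?D"]) auto
    let ?c = "a * Poly_Mapping.single x r * b" and ?z = "p + q + x"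
    \<comment> \<open>Only \<open>v = q\<close> contributes. For \<open>v\<close> outside
      \<open>?D\<close> this is the choice of \<open>x\<close>; for \<open>v\<close> inside,
      \<open>x\<close> commutes with \<open>v\<close>, so \<open>u + v = p + q\<close> with
      \<open>u\<close> in \<open>?D\<close>, and uniqueness gives \<open>v = q\<close>.\<close>
    have other: "lookup a (?z - v - x) = 0" if v: "v \<in> keys b" "v \<noteq> q" for v
    proof (rule ccontr)
      define u where "u = ?z - v - x"
      assume "lookup a (?z - v - x) \<noteq> 0"
      then have u: "u \<in> keys a" by (simp add: u_def in_keys_iff)
      have eq: "u + (x + v - x) = p + q"
        by (simp add: u_def add.assoc diff_conv_add_uminus del: add_uminus_conv_diff)
      show False
      proof (cases "v \<in> ?D")
        case False
        moreover have "x + v - x = - u + (p + q)" using eq by (metis minus_add_cancel)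
        ultimately show False using sep[of v] v u by blast
      next
        case True
        then have "x + v = v + x" using x v by (auto simp: centralizer_def)
        then have uv: "u + v = p + q" using eq by simp
        then have "u = (p + q) + - v" by (metis add_diff_cancel diff_conv_add_uminus)
        moreover have "(p + q) + - v \<in> ?D" using pq by (intro Dadd Dneg True) auto
        ultimately have "u \<in> ?D" by simp
        with uniq[of u v] uv u v True show False by blast
      qed
    qed
    have "x + q = q + x" using x pq by (auto simp: centralizer_def)
    then have "?z = p + x + q" by (simp add: add.assoc)
    then have "?z - q - x = p"
      by (simp add: add.assoc diff_conv_add_uminus del: add_uminus_conv_diff)
    then have "lookup ?c ?z = lookup a p * r * lookup b q"
      unfolding lookup_mult_right[of "a * _"] lookup_mult_single
      using pq other by (subst sum.remove[of _ q]) auto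
    moreover have "?c = 0" using AB A a b by (auto simp: is_ideal_def)
    ultimately show False using r by (metis lookup_zero)
  qed
qed

theorem theorem1p5:
  assumes "s_unital TYPE('r::ring)"
  shows "prime_ring TYPE('g::group_add \<Rightarrow>\<^sub>0 'r) \<longleftrightarrow>
           prime_ring TYPE('r) \<and>
           \<not> (\<exists>N :: 'g set. is_normal_subgroup N \<and> finite N \<and> N \<noteq> {0})"
proof -
  have "prime_ring TYPE('g \<Rightarrow>\<^sub>0 'r) \<longleftrightarrow> prime_ring TYPE('r) \<and> no_finite_normal TYPE('g)"
    by (intro iffI conjI)
      (simp_all add: prime_coefficient_ring prime_group_ring_no_finite_normal
        prime_group_ring[OF assms])
  then show ?thesis by (simp only: no_finite_normal_def)
qed

end
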